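(* Let $(X,\mathcal{E})$ be a connected coarse space and let $\mathcal{B}$ be the bornology induced by $\mathcal{E}$. The relation $\prec$ on the power set of $X$ (defined by: $A\prec B$ if for every $E\in\mathcal{E}$ there is a bounded set $K\subseteq X$ with $E[A]\subseteq B\cup K$) induces a coarse proximity on the pair $(X,\mathcal{B})$ if and only if $(X,\mathcal{E})$ is coarsely normal.
   Context: A coarse structure on a set $X$ is a collection $\mathcal{E}$ of subsets of $X\times X$ (called controlled sets or entourages) that contains the diagonal $\triangle=\{(x,x)\mid x\in X\}$ and is closed under taking subsets, inverses $E^{-1}=\{(x,y)\mid (y,x)\in E\}$, finite unions, and compositions $E\circ F=\{(x,y)\mid \exists z\in X,\ (x,z)\in E,\ (z,y)\in F\}$. The pair $(X,\mathcal{E})$ is a coarse space. It is connected if each point of $X\times X$ belongs to some controlled set. For $A\subseteq X$ and $E\in\mathcal{E}$, $E[A]=\{x\in X\mid \exists a\in A,\ (x,a)\in E\}$. A subset $A\subseteq X$ is (coarsely) bounded if $A\times A\in\mathcal{E}$, and unbounded otherwise. A bornology on $X$ is a family $\mathcal{B}$ of subsets of $X$ containing all singletons and closed under subsets and finite (binary) unions. For a connected coarse space, the bounded sets form a bornology, called the bornology induced by $\mathcal{E}$. $(X,\mathcal{E})$ is coarsely normal if for all $A,B\subseteq X$ with $A\prec B$ there is $C\subseteq X$ with $A\prec C\prec B$. A coarse proximity on a set $X$ with bornology $\mathcal{B}$ is a relation $\mathbf{b}$ on the power set of $X$ such that for all $A,B,C\subseteq X$ (writing $\bar{\mathbf{b}}$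 for the negation of $\mathbf{b}$): (i) $A\mathbf{b}B$ implies $B\mathbf{b}A$; (ii) $A\mathbf{b}B$ implies $A\notin\mathcal{B}$ and $B\notin\mathcal{B}$; (iii) $A\cap B\notin\mathcal{B}$ implies $A\mathbf{b}B$; (iv) $(A\cup B)\mathbf{b}C$ if and only if $A\mathbf{b}C$ or $B\mathbf{b}C$; (v) $A\bar{\mathbf{b}}B$ implies that there exists $E\subseteq X$ with $A\bar{\mathbf{b}}E$ and $(X\setminus E)\bar{\mathbf{b}}B$. A binary relation $\ll$ on the power set of $X$ induces a coarse proximity on the pair $(X,\mathcal{B})$ if it satisfies, for all subsets of $X$: (1) $X\ll (X\setminus D)$ for all $D\in\mathcal{B}$; (2) $A\ll B$ implies there exists $D\in\mathcal{B}$ with $A\setminus D\subseteq B$; (3) $A\subseteq B\ll C\subseteq D$ implies $A\ll D$; (4) $A\ll B_1$ and $A\ll B_2$ if and only if $A\ll (B_1\cap B_2)$; (5) $A\ll B$ if and only if $(X\setminus B)\ll (X\setminus A)$; (6) $A\ll B$ implies that there exists $C\subseteq X$ with $A\ll C\ll B$. The induced coarse proximity is then the relation $\mathbf{b}$ given by $A\bar{\mathbf{b}}B$ if and only if $A\ll (X\setminus B)$. *)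

theory Defs
  imports Main
begin

locale coarse_space =
  fixes X :: "'a set" and \<E> :: "('a \<times> 'a) set set"
  assumes controlled_subset: "E \<in> \<E> \<Longrightarrow> E \<subseteq> X \<times> X"
    and diagonal: "Id_on X \<in> \<E>"
    and subset_closed: "E \<in> \<E> \<Longrightarrow> F \<subseteq> E \<Longrightarrow> F \<in> \<E>"
    and inverse_closed: "E \<in> \<E> \<Longrightarrow> E\<inverse> \<in> \<E>"
    and union_closed: "E \<in> \<E> \<Longrightarrow> F \<in> \<E> \<Longrightarrow> E \<union> F \<in> \<E>"
    and composition_closed: "E \<in> \<E> \<Longrightarrow> F \<in> \<E> \<Longrightarrow> E O F \<in> \<E>"

locale connected_coarse_space = coarse_space +
  assumes connected: "p \<in> X \<times> X \<Longrightarrow> \<exists>E\<in>\<E>. p \<in> E"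

(* E[A] collects first components related to a point of A, so it is the image of A
   under the inverse of E in the convention of Relation.Image. *)
definition coarse_nbhd :: "'a set \<Rightarrow> ('a \<times> 'a) set \<Rightarrow> 'a set \<Rightarrow> 'a set" where
  "coarse_nbhd X E A = {x \<in> X. \<exists>a\<in>A. (x, a) \<in> E}"

definition bounded_sets :: "'a set \<Rightarrow> ('a \<times> 'a) set set \<Rightarrow> 'a set set" where
  "bounded_sets X \<E> = {A. A \<subseteq> X \<and> A \<times> A \<in> \<E>}"

definition coarse_prec :: "'a set \<Rightarrow> ('a \<times> 'a) set set \<Rightarrow> 'a set \<Rightarrow> 'a set \<Rightarrow> bool" where
  "coarse_prec X \<E> A B \<longleftrightarrow>
     (\<forall>E\<in>\<E>. \<exists>K\<in>bounded_sets X \<E>. coarse_nbhd X E A \<subseteq> B \<union> K)"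

definition coarsely_normal :: "'a set \<Rightarrow> ('a \<times> 'a) set set \<Rightarrow> bool" where
  "coarsely_normal X \<E> \<longleftrightarrow>
     (\<forall>A B. A \<subseteq> X \<longrightarrow> B \<subseteq> X \<longrightarrow> coarse_prec X \<E> A B \<longrightarrow>
        (\<exists>C\<subseteq>X. coarse_prec X \<E> A C \<and> coarse_prec X \<E> C B))"

locale bornology =
  fixes X :: "'a set" and \<B> :: "'a set set"
  assumes bornology_subset: "B \<in> \<B> \<Longrightarrow> B \<subseteq> X"
    and singletons: "x \<in> X \<Longrightarrow> {x} \<in> \<B>"
    and subset_closed: "B \<in> \<B> \<Longrightarrow> A \<subseteq> B \<Longrightarrow> A \<in> \<B>"
    and union_closed: "A \<in> \<B> \<Longrightarrow> B \<in> \<B> \<Longrightarrow> A \<union> B \<in> \<B>"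

(* A relation on the power set of X is represented by a predicate on all pairs of sets;
   only its values on subsets of X matter. *)
locale coarse_proximity = bornology +
  fixes b :: "'a set \<Rightarrow> 'a set \<Rightarrow> bool"
  assumes symmetric: "A \<subseteq> X \<Longrightarrow> B \<subseteq> X \<Longrightarrow> b A B \<Longrightarrow> b B A"
    and unbounded: "A \<subseteq> X \<Longrightarrow> B \<subseteq> X \<Longrightarrow> b A B \<Longrightarrow> A \<notin> \<B> \<and> B \<notin> \<B>"
    and intersecting: "A \<subseteq> X \<Longrightarrow> B \<subseteq> X \<Longrightarrow> A \<inter> B \<notin> \<B> \<Longrightarrow> b A B"
    and union_iff: "A \<subseteq> X \<Longrightarrow> B \<subseteq> X \<Longrightarrow> C \<subseteq> X \<Longrightarrow> b (A \<union> B) C \<longleftrightarrow> b A C \<or> b B C"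
    and strong: "A \<subseteq> X \<Longrightarrow> B \<subseteq> X \<Longrightarrow> \<not> b A B \<Longrightarrow>
                   \<exists>E\<subseteq>X. \<not> b A E \<and> \<not> b (X - E) B"

locale induces_coarse_proximity =
  fixes X :: "'a set" and \<B> :: "'a set set" and ll :: "'a set \<Rightarrow> 'a set \<Rightarrow> bool"
    (infix "\<lless>" 50)
  assumes top_cobounded: "D \<subseteq> X \<Longrightarrow> D \<in> \<B> \<Longrightarrow> X \<lless> X - D"
    and almost_subset: "A \<subseteq> X \<Longrightarrow> B \<subseteq> X \<Longrightarrow> A \<lless> B \<Longrightarrow> \<exists>D\<in>\<B>. A - D \<subseteq> B"
    and monotone: "A \<subseteq> B \<Longrightarrow> B \<subseteq> X \<Longrightarrow> C \<subseteq> D \<Longrightarrow> D \<subseteq> X \<Longrightarrow> B \<lless> C \<Longrightarrow> A \<lless> D"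
    and inter_iff: "A \<subseteq> X \<Longrightarrow> B1 \<subseteq> X \<Longrightarrow> B2 \<subseteq> X \<Longrightarrow>
                      A \<lless> B1 \<and> A \<lless> B2 \<longleftrightarrow> A \<lless> B1 \<inter> B2"
    and complement_iff: "A \<subseteq> X \<Longrightarrow> B \<subseteq> X \<Longrightarrow> A \<lless> B \<longleftrightarrow> X - B \<lless> X - A"
    and interpolation: "A \<subseteq> X \<Longrightarrow> B \<subseteq> X \<Longrightarrow> A \<lless> B \<Longrightarrow> \<exists>C\<subseteq>X. A \<lless> C \<and> C \<lless> B"

definition induced_proximity ::
    "'a set \<Rightarrow> ('a set \<Rightarrow> 'a set \<Rightarrow> bool) \<Rightarrow> 'a set \<Rightarrow> 'a set \<Rightarrow> bool" where
  "induced_proximity X ll A B \<longleftrightarrow> \<not> ll A (X - B)"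

(* The next two lemmas justify the terminology: the bounded sets of a connected coarse
   space are a bornology, and the six axioms of induces_coarse_proximity make the
   induced relation a coarse proximity. *)
lemma bornology_bounded_sets:
  assumes "connected_coarse_space X \<E>"
  shows "bornology X (bounded_sets X \<E>)"
proof -
  interpret connected_coarse_space X \<E> by (rule assms)
  show ?thesis
  proof
    fix B assume "B \<in> bounded_sets X \<E>"
    then show "B \<subseteq> X" by (simp add: bounded_sets_def)
  next
    fix x assume "x \<in> X"
    moreover have "{x} \<times> {x} \<in> \<E>"
      by (rule subset_closed[OF diagonal]) (use \<open>x \<in> X\<close> in auto)
    ultimately show "{x} \<in> bounded_sets X \<E>" by (simp add: bounded_sets_def)
  next
    fix A B assume "B \<in> bounded_sets X \<E>" "A \<subseteq> B"
    then show "A \<in> bounded_sets X \<E>"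
      using subset_closed[of "B \<times> B" "A \<times> A"] by (auto simp: bounded_sets_def)
  next
    fix A B assume AB: "A \<in> bounded_sets X \<E>" "B \<in> bounded_sets X \<E>"
    show "A \<union> B \<in> bounded_sets X \<E>"
    proof (cases "A = {} \<or> B = {}")
      case True
      then show ?thesis using AB by auto
    next
      case False
      then obtain x y where xy: "x \<in> A" "y \<in> B" by auto
      then have "(x, y) \<in> X \<times> X" using AB by (auto simp: bounded_sets_def)
      then obtain E where E: "E \<in> \<E>" "(x, y) \<in> E" using connected by blast
      define F where "F = A \<times> A \<union> B \<times> B \<union> (E \<union> E\<inverse>)"
      have F: "F \<in> \<E>"
        unfolding F_def using AB E(1)
        by (auto simp: bounded_sets_def intro!: union_closed inverse_closed)
      have "(A \<union> B) \<times> (A \<union> B) \<subseteq> F O F O F"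
        using xy E(2) unfolding F_def by blast
      moreover have "F O F O F \<in> \<E>" using F by (intro composition_closed)
      ultimately show ?thesis
        using AB subset_closed by (auto simp: bounded_sets_def)
    qed
  qed
qed

lemma coarse_proximity_induced:
  assumes "bornology X \<B>" and "induces_coarse_proximity X \<B> ll"
  shows "coarse_proximity X \<B> (induced_proximity X ll)"
proof -
  interpret bornology X \<B> by (rule assms)
  interpret induces_coarse_proximity X \<B> ll by (rule assms)
  have sym: "ll A (X - B) \<longleftrightarrow> ll B (X - A)" if "A \<subseteq> X" "B \<subseteq> X" for A B
    using complement_iff[of A "X - B"] that by (simp add: double_diff)
  have bdd: "ll A (X - B)" if "A \<subseteq> X" "B \<subseteq> X" "B \<in> \<B>" for A B
    using monotone[of A X "X - B" "X - B"] top_cobounded[of B] that by auto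
  show ?thesis
  proof (unfold_locales, unfold induced_proximity_def)
    fix A B assume "A \<subseteq> X" "B \<subseteq> X" "\<not> ll A (X - B)"
    then show "\<not> ll B (X - A)" using sym by blast
  next
    fix A B assume "A \<subseteq> X" "B \<subseteq> X" "\<not> ll A (X - B)"
    then show "A \<notin> \<B> \<and> B \<notin> \<B>" using sym bdd by blast
  next
    fix A B assume AB: "A \<subseteq> X" "B \<subseteq> X" "A \<inter> B \<notin> \<B>"
    show "\<not> ll A (X - B)"
    proof
      assume "ll A (X - B)"
      then obtain D where "D \<in> \<B>" "A - D \<subseteq> X - B"
        using almost_subset[of A "X - B"] AB by auto
      then show False using subset_closed[of D "A \<inter> B"] AB by blast
    qed
  next
    fix A B C assume "A \<subseteq> X" "B \<subseteq> X" "C \<subseteq> X"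
    then show "(\<not> ll (A \<union> B) (X - C)) = (\<not> ll A (X - C) \<or> \<not> ll B (X - C))"
      using inter_iff[of C "X - A" "X - B"] sym[of "A \<union> B" C] sym[of A C] sym[of B C]
      by (auto simp: Diff_Un)
  next
    fix A B assume AB: "A \<subseteq> X" "B \<subseteq> X" "\<not> \<not> ll A (X - B)"
    then obtain C where "C \<subseteq> X" "ll A C" "ll C (X - B)"
      using interpolation[of A "X - B"] by auto
    then show "\<exists>E\<subseteq>X. \<not> \<not> ll A (X - E) \<and> \<not> \<not> ll (X - E) (X - B)"
      by (intro exI[of _ "X - C"]) (simp add: double_diff)
  qed
qed

end

theory Submission
  imports Defs
begin

text \<open>
  The interpolation axiom for \<open>\<prec>\<close> is literally coarse normality, so it remains to see that the
  other five axioms hold in every connected coarse space.  Only the complement axiom is more than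
  bookkeeping with the bornology: if \<open>A \<prec> B\<close> and \<open>E\<close> is controlled, then \<open>E\<inverse>[A] \<subseteq> B \<union> K\<close> with \<open>K\<close>
  bounded, so a point of \<open>A\<close> lying in \<open>E[X - B]\<close> is related by \<open>E\<close> to a point of \<open>K\<close>; that is,
  \<open>E[X - B] \<subseteq> (X - A) \<union> E[K]\<close>.  Here \<open>E[K]\<close> is bounded
  because neighbourhoods of bounded sets are bounded.
\<close>

lemma (in coarse_space) coarse_nbhd_bounded:
  assumes "E \<in> \<E>" "K \<in> bounded_sets X \<E>"
  shows "coarse_nbhd X E K \<in> bounded_sets X \<E>"
proof -
  have "coarse_nbhd X E K \<times> coarse_nbhd X E K \<subseteq> E O (K \<times> K) O E\<inverse>"
    unfolding coarse_nbhd_def by blast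
  moreover have "E O (K \<times> K) O E\<inverse> \<in> \<E>"
    using assms by (intro composition_closed inverse_closed) (auto simp: bounded_sets_def)
  ultimately have "coarse_nbhd X E K \<times> coarse_nbhd X E K \<in> \<E>"
    by (rule subset_closed[rotated])
  then show ?thesis
    by (auto simp: bounded_sets_def coarse_nbhd_def)
qed

lemma (in coarse_space) coarse_prec_top_cobounded:
  assumes "D \<in> bounded_sets X \<E>"
  shows "coarse_prec X \<E> X (X - D)"
  using assms unfolding coarse_prec_def coarse_nbhd_def by blast

lemma (in coarse_space) coarse_prec_almost_subset:
  assumes "A \<subseteq> X" "coarse_prec X \<E> A B"
  shows "\<exists>D\<in>bounded_sets X \<E>. A - D \<subseteq> B"
proof -
  obtain K where K: "K \<in> bounded_sets X \<E>" "coarse_nbhd X (Id_on X) A \<subseteq> B \<union> K"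
    using assms(2) diagonal unfolding coarse_prec_def by blast
  moreover have "coarse_nbhd X (Id_on X) A = A"
    using assms(1) unfolding coarse_nbhd_def by blast
  ultimately show ?thesis by blast
qed

lemma coarse_prec_mono:
  assumes "A \<subseteq> B" "C \<subseteq> D" "coarse_prec X \<E> B C"
  shows "coarse_prec X \<E> A D"
  unfolding coarse_prec_def
proof
  fix E assume "E \<in> \<E>"
  then obtain K where "K \<in> bounded_sets X \<E>" "coarse_nbhd X E B \<subseteq> C \<union> K"
    using assms(3) unfolding coarse_prec_def by blast
  moreover have "coarse_nbhd X E A \<subseteq> coarse_nbhd X E B"
    using assms(1) unfolding coarse_nbhd_def by blast
  ultimately show "\<exists>K\<in>bounded_sets X \<E>. coarse_nbhd X E A \<subseteq> D \<union> K"
    using assms(2) by blast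
qed

lemma (in connected_coarse_space) coarse_prec_Int:
  assumes "coarse_prec X \<E> A B1" "coarse_prec X \<E> A B2"
  shows "coarse_prec X \<E> A (B1 \<inter> B2)"
  unfolding coarse_prec_def
proof
  fix E assume "E \<in> \<E>"
  then obtain K1 K2 where K: "K1 \<in> bounded_sets X \<E>" "coarse_nbhd X E A \<subseteq> B1 \<union> K1"
    "K2 \<in> bounded_sets X \<E>" "coarse_nbhd X E A \<subseteq> B2 \<union> K2"
    using assms unfolding coarse_prec_def by meson
  have "K1 \<union> K2 \<in> bounded_sets X \<E>"
    using bornology.union_closed[OF bornology_bounded_sets[OF connected_coarse_space_axioms]] K
    by blast
  then show "\<exists>K\<in>bounded_sets X \<E>. coarse_nbhd X E A \<subseteq> (B1 \<inter> B2) \<union> K"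
    using K by blast
qed

lemma (in coarse_space) coarse_prec_complement:
  assumes "A \<subseteq> X" "coarse_prec X \<E> A B"
  shows "coarse_prec X \<E> (X - B) (X - A)"
  unfolding coarse_prec_def
proof
  fix E assume E: "E \<in> \<E>"
  obtain K where K: "K \<in> bounded_sets X \<E>" "coarse_nbhd X (E\<inverse>) A \<subseteq> B \<union> K"
    using assms(2) inverse_closed[OF E] unfolding coarse_prec_def by blast
  have "coarse_nbhd X E (X - B) \<subseteq> (X - A) \<union> coarse_nbhd X E K"
    using assms(1) K(2) unfolding coarse_nbhd_def by blast
  then show "\<exists>K\<in>bounded_sets X \<E>. coarse_nbhd X E (X - B) \<subseteq> (X - A) \<union> K"
    using coarse_nbhd_bounded[OF E K(1)] by blast
qed

theorem theorem4p1:
  fixes X :: "'a set" and \<E> :: "('a \<times> 'a) set set"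
  assumes "connected_coarse_space X \<E>"
  shows "induces_coarse_proximity X (bounded_sets X \<E>) (coarse_prec X \<E>)
         \<longleftrightarrow> coarsely_normal X \<E>"
proof
  assume "induces_coarse_proximity X (bounded_sets X \<E>) (coarse_prec X \<E>)"
  from induces_coarse_proximity.interpolation[OF this] show "coarsely_normal X \<E>"
    unfolding coarsely_normal_def by blast
next
  assume normal: "coarsely_normal X \<E>"
  interpret connected_coarse_space X \<E> by (rule assms)
  show "induces_coarse_proximity X (bounded_sets X \<E>) (coarse_prec X \<E>)"
  proof
    fix D assume "D \<in> bounded_sets X \<E>"
    then show "coarse_prec X \<E> X (X - D)" by (rule coarse_prec_top_cobounded)
  next
    fix A B assume "A \<subseteq> X" "coarse_prec X \<E> A B"
    then show "\<exists>D\<in>bounded_sets X \<E>. A - D \<subseteq> B" by (rule coarse_prec_almost_subset)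
  next
    fix A B C D :: "'a set" assume "A \<subseteq> B" "C \<subseteq> D" "coarse_prec X \<E> B C"
    then show "coarse_prec X \<E> A D" by (rule coarse_prec_mono)
  next
    fix A B1 B2
    show "coarse_prec X \<E> A B1 \<and> coarse_prec X \<E> A B2 \<longleftrightarrow> coarse_prec X \<E> A (B1 \<inter> B2)"
      using coarse_prec_Int coarse_prec_mono[of A A "B1 \<inter> B2"] by blast
  next
    fix A B assume "A \<subseteq> X" "B \<subseteq> X"
    then show "coarse_prec X \<E> A B \<longleftrightarrow> coarse_prec X \<E> (X - B) (X - A)"
      using coarse_prec_complement[of A B] coarse_prec_complement[of "X - B" "X - A"]
      by (auto simp: double_diff)
  next
    fix A B assume "A \<subseteq> X" "B \<subseteq> X" "coarse_prec X \<E> A B"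
    then show "\<exists>C\<subseteq>X. coarse_prec X \<E> A C \<and> coarse_prec X \<E> C B"
      using normal unfolding coarsely_normal_def by blast
  qed
qed

end
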